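(* Let $n,m>1$ be coprime integers. Then $G_{n,m,2}$ is Hamiltonian if and only if $G_{n,m+12n,2}$ is Hamiltonian.
   Context: For integers $n,m>1$, the graph $G_{n,m,2}$ (an augmented directed grid graph on a two-holed torus) is defined as follows. Its vertices are the $4nm$ cells $(i,c)$ of a grid with $2n$ rows $0\le i<2n$ (row $0$ on top) and $2m$ columns $0\le c<2m$ (column $0$ leftmost). The bijection $u$ ("up") on cells is $u(i,c)=(i-1,c)$ if $i\ge 1$, and $u(0,c)=(2n-1,(c+m)\bmod 2m)$. The bijection $r$ ("right") on cells is $r(i,c)=(i,c+1)$ if $c<2m-1$, and $r(i,2m-1)=((i+n)\bmod 2n,0)$. The directed edges are $(\alpha,u\alpha)$ and $(\alpha,r\alpha)$ for every cell $\alpha$. A directed graph is Hamiltonian if it has a directed cycle visiting every vertex exactly once. *)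

theory Defs
  imports "Graph_Theory.Graph_Theory"
begin

text \<open>A cell is a pair (row, column); row 0 is the top row and column 0 the leftmost column.\<close>

definition cells :: "nat \<Rightarrow> nat \<Rightarrow> (nat \<times> nat) set" where
  "cells n m = {0..<2 * n} \<times> {0..<2 * m}"

definition up :: "nat \<Rightarrow> nat \<Rightarrow> nat \<times> nat \<Rightarrow> nat \<times> nat" where
  "up n m = (\<lambda>(i, c). if i \<ge> 1 then (i - 1, c) else (2 * n - 1, (c + m) mod (2 * m)))"

definition right :: "nat \<Rightarrow> nat \<Rightarrow> nat \<times> nat \<Rightarrow> nat \<times> nat" where
  "right n m = (\<lambda>(i, c). if c < 2 * m - 1 then (i, c + 1) else ((i + n) mod (2 * n), 0))"

definition grid2 :: "nat \<Rightarrow> nat \<Rightarrow> (nat \<times> nat) pair_pre_digraph" where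
  "grid2 n m = \<lparr> pverts = cells n m,
     parcs = {(\<alpha>, up n m \<alpha>) | \<alpha>. \<alpha> \<in> cells n m} \<union> {(\<alpha>, right n m \<alpha>) | \<alpha>. \<alpha> \<in> cells n m} \<rparr>"

text \<open>The library's cycles are directed, nonempty and repeat no vertex except that the first is also
  the last, so the vertices on a cycle are exactly the tails of its arcs.\<close>

definition hamiltonian :: "('a, 'b) pre_digraph \<Rightarrow> bool" where
  "hamiltonian G \<longleftrightarrow> (\<exists>p. pre_digraph.cycle G p \<and> tail G ` set p = verts G)"

lemma up_in_cells: "\<alpha> \<in> cells n m \<Longrightarrow> up n m \<alpha> \<in> cells n m"
  by (auto simp: cells_def up_def split: prod.splits)

lemma right_in_cells: "\<alpha> \<in> cells n m \<Longrightarrow> right n m \<alpha> \<in> cells n m"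
  by (auto simp: cells_def right_def split: prod.splits)

lemma pair_wf_digraph_grid2: "pair_wf_digraph (grid2 n m)"
  by unfold_locales (auto simp: grid2_def up_in_cells right_in_cells)

end

theory Submission
  imports Defs
begin

text \<open>
  A Hamiltonian cycle chooses at each vertex \<open>\<alpha>\<close> either \<open>up\<close> or \<open>right\<close>, and injectivity forces the
  choice to be the same at \<open>\<alpha>\<close> and \<open>\<beta>\<close> whenever \<open>up \<alpha> = right \<beta>\<close>. The surface is a single
  vertical cylinder of \<open>m\<close> columns and circumference \<open>4n\<close>, so in sheared coordinates the choice is
  described by one set \<open>F\<close> of rows modulo \<open>4n\<close>: a vertex steps right exactly when the next row lies
  in \<open>F\<close>. Crossing a column moves an element of \<open>F\<close> to the cyclically next one, so the first return
  to column 0 is \<open>g \<circ> next\<^sup>m\<close>, where the map \<open>g\<close> that glues the two ends of the cylinder preserves \<open>F\<close>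
  and depends on \<open>m\<close> only modulo \<open>4n\<close>. Since \<open>g\<close> shifts residues modulo \<open>n\<close> by \<open>-m\<close> and \<open>n, m\<close> are
  coprime, \<open>F\<close> meets all residue classes modulo \<open>n\<close> equally often, at most four times. Hence
  \<open>card F\<close> divides \<open>12n\<close>, and replacing \<open>m\<close> by \<open>m + 12n\<close> changes neither \<open>g\<close> nor \<open>next\<^sup>m\<close>.
\<close>

section \<open>Hamiltonian cycles and cyclic maps\<close>

lemma funpow_eq_along_walk:
  assumes "pcas u p v" and "\<And>a b. (a, b) \<in> set p \<Longrightarrow> f a = b"
  shows "(f ^^ length p) u = v \<and> fst ` set p \<subseteq> {(f ^^ i) u | i. i < length p}"
  using assms
proof (induction p arbitrary: u)
  case (Cons e p)
  obtain b where e: "e = (u, b)" and p: "pcas b p v"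
    using Cons.prems(1) by (cases e) auto
  have fu: "f u = b" using Cons.prems(2) e by auto
  have IH: "(f ^^ length p) b = v" "fst ` set p \<subseteq> {(f ^^ i) b | i. i < length p}"
    using Cons.IH[OF p] Cons.prems(2) by auto
  have shift: "(f ^^ i) b = (f ^^ Suc i) u" for i
    by (simp add: fu funpow_swap1)
  have "fst ` set p \<subseteq> {(f ^^ i) u | i. i < Suc (length p)}"
    using IH(2) unfolding shift by fastforce
  then show ?case
    using IH(1) e unfolding shift by (auto intro: exI[of _ 0])
qed simp

lemma pcas_funpow:
  "pcas ((f ^^ a) x) (map (\<lambda>i. ((f ^^ i) x, (f ^^ Suc i) x)) [a..<a + k]) ((f ^^ (a + k)) x)"
proof (induction k arbitrary: a)
  case (Suc k)
  show ?case using Suc[of "Suc a"] by (simp add: upt_conv_Cons del: upt_Suc)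
qed simp

text \<open>A Hamiltonian cycle is the same as a successor map along arcs: read each arc of the
  cycle as tail to head, or conversely trace the single orbit of the map until it closes.\<close>

lemma hamiltonian_iff_cyclic_on:
  assumes "pair_wf_digraph G"
  shows "hamiltonian (with_proj G) \<longleftrightarrow>
    (\<exists>f. (\<forall>v\<in>pverts G. (v, f v) \<in> parcs G) \<and> cyclic_on f (pverts G))"
proof -
  interpret pair_wf_digraph G by fact
  show ?thesis
  proof
    assume "hamiltonian (with_proj G)"
    then obtain p u where p: "awalk u p u" "distinct (tl (pawalk_verts u p))" "p \<noteq> []"
      and V: "fst ` set p = pverts G"
      unfolding hamiltonian_def cycle_def by auto
    have cas: "pcas u p u" and arcs: "set p \<subseteq> parcs G"
      using p(1) by (auto simp: awalk_def)
    have vs: "pawalk_verts u p = map fst p @ [snd (last p)]"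
      "pawalk_verts u p = fst (hd p) # map snd p"
      using awalk_verts_conv[of u p] awalk_verts_conv'[OF cas] p(3) by auto
    have "fst (hd p) = u" "snd (last p) = u"
      using awalkE[OF p(1)] vs p(3) by (metis list.sel(1), metis last_snoc)
    then have ends: "map fst p = u # tl (map fst p)" "tl (pawalk_verts u p) = tl (map fst p) @ [u]"
      using p(3) unfolding vs(1) by (metis list.collapse list.map_disc_iff list.map_sel(1), simp)
    \<comment> \<open>The cycle condition makes the heads distinct, and the heads are the tails
      rotated by one place.\<close>
    have "distinct (map fst p)"
      using p(2) unfolding ends(2) by (subst ends(1)) simp
    \<comment> \<open>The arc list is read as a finite map from tails to heads; the distinct tails
      make it single-valued.\<close>
    define f where "f = the \<circ> map_of p"
    have f: "f a = b" if "(a, b) \<in> set p" for a b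
      using that \<open>distinct (map fst p)\<close> by (simp add: f_def)
    have closed: "(v, f v) \<in> parcs G" if "v \<in> pverts G" for v
      using that arcs f unfolding V[symmetric] by auto
    have walk: "(f ^^ length p) u = u" "fst ` set p \<subseteq> {(f ^^ i) u | i. i < length p}"
      using funpow_eq_along_walk[OF cas f] by auto
    have u: "u \<in> pverts G" using p(1) by (simp add: awalk_def)
    have "orbit f u = {(f ^^ i) u | i. i < length p}"
      using walk(1) p(3) by (intro orbit_altdef_bounded) auto
    moreover have "y \<in> pverts G" if "y \<in> orbit f u" for y
      using that u closed in_arcsD2 by (induction) auto
    ultimately have "pverts G = orbit f u"
      using walk(2) V by auto
    then have "cyclic_on f (pverts G)"
      using u by (intro cyclic_on_singleI)
    then show "\<exists>f. (\<forall>v\<in>pverts G. (v, f v) \<in> parcs G) \<and> cyclic_on f (pverts G)"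
      using closed by blast
  next
    assume "\<exists>f. (\<forall>v\<in>pverts G. (v, f v) \<in> parcs G) \<and> cyclic_on f (pverts G)"
    then obtain f where f: "\<And>v. v \<in> pverts G \<Longrightarrow> (v, f v) \<in> parcs G"
      and cyc: "cyclic_on f (pverts G)" by blast
    then obtain x where x: "x \<in> pverts G" and V: "pverts G = orbit f x"
      unfolding cyclic_on_def by auto
    define k where "k = funpow_dist1 f x x"
    define p where "p = map (\<lambda>i. ((f ^^ i) x, (f ^^ Suc i) x)) [0..<k]"
    have k: "(f ^^ k) x = x" "0 < k"
      unfolding k_def using x V by (intro funpow_dist1_prop, simp_all only: zero_less_Suc)
    have orb: "orbit f x = (\<lambda>n. (f ^^ n) x) ` {0..<k}"
      using x V unfolding k_def by (intro orbit_conv_funpow_dist1) auto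
    have inj: "inj_on (\<lambda>n. (f ^^ n) x) {0..<k}"
      using x V unfolding k_def by (intro inj_on_funpow_dist1) auto
    have cas: "pcas x p x"
      using pcas_funpow[where f = f and a = 0 and k = k and x = x] unfolding p_def by (simp only: k(1) add_0 funpow_0)
    have "set p \<subseteq> parcs G"
      using f cyclic_on_funpow_in[OF cyc x] by (auto simp: p_def)
    then have walk: "awalk x p x"
      using x cas by (simp add: awalk_def)
    have tl: "tl (pawalk_verts x p) = map snd p"
      using awalk_verts_conv'[OF cas] k(2) by (simp add: p_def)
    have "set (map snd p) = f ` orbit f x"
      by (auto simp: p_def orb image_image)
    also have "\<dots> = orbit f x"
    proof -
      have "f ` orbit f x = orbit f (f x)"
        using x V by (intro orbit_inverse) auto
      then show ?thesis using self_in_orbit_step x V by metis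
    qed
    \<comment> \<open>The list of heads has length \<open>k\<close>, and its set is the orbit, which
      has \<open>k\<close> elements.\<close>
    finally have "distinct (map snd p)"
      using card_image[OF inj] by (intro card_distinct) (simp add: orb p_def)
    moreover have "fst ` set p = pverts G"
      by (simp add: p_def V orb image_image)
    moreover have "p \<noteq> []" using k(2) by (simp add: p_def)
    ultimately have "cycle p" "fst ` set p = pverts G"
      unfolding cycle_def using walk tl by auto
    then show "hamiltonian (with_proj G)"
      unfolding hamiltonian_def by auto
  qed
qed

section \<open>Cyclic maps on finite sets and their first-return maps\<close>

lemma funpow_card_cyclic_on:
  assumes "cyclic_on f S" "x \<in> S"
  shows "(f ^^ card S) x = x"
proof -
  have S: "S = orbit f x" "x \<in> orbit f x"
    using assms by (auto simp: cyclic_on_alldef)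
  have "card S = funpow_dist1 f x x"
    unfolding S(1) orbit_conv_funpow_dist1[OF S(2)]
    using card_image[OF inj_on_funpow_dist1[OF S(2)]] by simp
  then show ?thesis using funpow_dist1_prop[OF S(2)] by simp
qed

lemma cyclic_on_surj:
  assumes "cyclic_on f S"
  shows "f ` S = S"
proof
  show "f ` S \<subseteq> S" using assms by (auto intro: cyclic_on_inI)
  show "S \<subseteq> f ` S"
  proof
    fix x assume x: "x \<in> S"
    then have S: "orbit f x = S" using assms by (intro orbit_cyclic_eq3)
    with x have "x \<in> orbit f x" by simp
    then show "x \<in> f ` S"
      by cases (use x S in auto)
  qed
qed

lemma cyclic_on_inj_on:
  assumes "cyclic_on f S"
  shows "inj_on f S"
  using finite_cyclic_on[OF assms] by (rule eq_card_imp_inj_on) (simp only: cyclic_on_surj[OF assms])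

lemma cyclic_on_conj:
  assumes "bij_betw h S T" "\<And>x. x \<in> S \<Longrightarrow> f x \<in> S" "\<And>x. x \<in> S \<Longrightarrow> g (h x) = h (f x)"
  shows "cyclic_on f S \<longleftrightarrow> cyclic_on g T"
proof
  assume "cyclic_on f S"
  then show "cyclic_on g T"
    using cyclic_on_image[of f S g h] assms by (simp add: bij_betw_def)
next
  assume T: "cyclic_on g T"
  define k where "k = the_inv_into S h"
  have k: "k ` T = S" "\<And>x. x \<in> S \<Longrightarrow> k (h x) = x" "\<And>y. y \<in> T \<Longrightarrow> k y \<in> S \<and> h (k y) = y"
    using assms(1) unfolding k_def
    by (auto simp: bij_betw_def the_inv_into_f_f f_the_inv_into_f the_inv_into_into
        the_inv_into_onto)
  have "f (k y) = k (g y)" if "y \<in> T" for y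
    using assms(2,3) k that by metis
  then show "cyclic_on f S"
    using cyclic_on_image[OF T, of f k] k(1) by simp
qed

text \<open>Positivity of \<open>k\<close> excludes the trivial return at time 0. If the path never
  comes back to \<open>W\<close>, the \<open>LEAST\<close> is unspecified.\<close>

definition first_return :: "('a \<Rightarrow> 'a) \<Rightarrow> 'a set \<Rightarrow> 'a \<Rightarrow> 'a" where
  "first_return f W x = (f ^^ (LEAST k. 0 < k \<and> (f ^^ k) x \<in> W)) x"

lemma first_return_eqI:
  assumes "0 < k" "(f ^^ k) x \<in> W" "\<And>j. 0 < j \<Longrightarrow> j < k \<Longrightarrow> (f ^^ j) x \<notin> W"
  shows "first_return f W x = (f ^^ k) x"
proof -
  have "(LEAST k. 0 < k \<and> (f ^^ k) x \<in> W) = k"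
    using assms by (intro Least_equality) (auto simp: not_less[symmetric])
  then show ?thesis by (simp add: first_return_def)
qed

lemma first_returnE:
  assumes "0 < k" "(f ^^ k) x \<in> W"
  obtains d where "0 < d" "d \<le> k" "(f ^^ d) x \<in> W" "first_return f W x = (f ^^ d) x"
    "\<forall>j. 0 < j \<longrightarrow> j < d \<longrightarrow> (f ^^ j) x \<notin> W"
proof -
  define d where "d = (LEAST k. 0 < k \<and> (f ^^ k) x \<in> W)"
  have "0 < d \<and> (f ^^ d) x \<in> W" unfolding d_def by (rule LeastI_ex) (use assms in blast)
  moreover have "d \<le> k" unfolding d_def by (rule Least_le) (use assms in blast)
  moreover have "(f ^^ j) x \<notin> W" if "0 < j" "j < d" for j
    using not_less_Least[of j "\<lambda>k. 0 < k \<and> (f ^^ k) x \<in> W"] that unfolding d_def by auto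
  ultimately show ?thesis
    using that[of d] by (auto simp: first_return_def d_def)
qed

text \<open>Any later visit to \<open>W\<close> is a composition of first returns, so a single
  \<open>f\<close>-orbit restricts to a single orbit of the return map. Conversely, every point of
  \<open>V\<close> lies on a forward path from \<open>W\<close>, so one orbit on \<open>W\<close>
  sweeps out all of \<open>V\<close>.\<close>

lemma cyclic_on_first_return:
  assumes "W \<subseteq> V" "W \<noteq> {}" and closed: "\<And>v. v \<in> V \<Longrightarrow> f v \<in> V"
    and cover: "\<And>v. v \<in> V \<Longrightarrow> \<exists>w\<in>W. \<exists>k. v = (f ^^ k) w"
    and returns: "\<And>w. w \<in> W \<Longrightarrow> \<exists>k>0. (f ^^ k) w \<in> W"
  shows "cyclic_on f V \<longleftrightarrow> cyclic_on (first_return f W) W"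
proof -
  let ?T = "first_return f W"
  have in_orbit: "?T w \<in> orbit f w" "?T w \<in> W" if "w \<in> W" for w
  proof -
    obtain k where "0 < k" "(f ^^ k) w \<in> W" using returns[OF \<open>w \<in> W\<close>] by auto
    then obtain d where "0 < d" "(f ^^ d) w \<in> W" "?T w = (f ^^ d) w"
      by (rule first_returnE)
    then show "?T w \<in> orbit f w" "?T w \<in> W" by (auto simp: orbit_altdef)
  qed
  have T_orbit: "y \<in> orbit f w \<and> y \<in> W" if "y \<in> orbit ?T w" "w \<in> W" for y w
    using that(1)
  proof induction
    case base
    then show ?case using in_orbit that(2) by simp
  next
    case (step y)
    then show ?case using in_orbit[of y] orbit_trans[of "?T y" f y w] by simp
  qed
  show ?thesis
  proof
    assume cyc: "cyclic_on f V"
    \<comment> \<open>Strong induction on the time \<open>k\<close>: the first return uses up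
      \<open>d\<close> steps, and the remaining \<open>k - d\<close> steps start in \<open>W\<close>
      again.\<close>
    have reach: "(f ^^ k) w \<in> orbit ?T w" if "w \<in> W" "0 < k" "(f ^^ k) w \<in> W" for k w
      using that
    proof (induction k arbitrary: w rule: less_induct)
      case (less k)
      obtain d where d: "0 < d" "d \<le> k" "?T w = (f ^^ d) w"
        using first_returnE[OF less.prems(2,3)] by metis
      show ?case
      proof (cases "d = k")
        case True
        then show ?thesis using orbit.base[of ?T w] d(3) by simp
      next
        case False
        have eq: "(f ^^ (k - d)) (?T w) = (f ^^ k) w"
          using d funpow_add[where m = "k - d" and n = d and f = f] by simp
        have "(f ^^ (k - d)) (?T w) \<in> orbit ?T (?T w)"
          by (rule less.IH) (use d False in_orbit(2)[OF less.prems(1)] less.prems(3) eq in simp_all)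
        then show ?thesis unfolding eq by (rule orbit_subset)
      qed
    qed
    obtain w where w: "w \<in> W" using assms(2) by auto
    have "W \<subseteq> orbit ?T w"
    proof
      fix y assume y: "y \<in> W"
      then have "y \<in> orbit f w"
        using orbit_cyclic_eq3[OF cyc, of w] w assms(1) by auto
      then show "y \<in> orbit ?T w"
        using reach[OF w] y by (auto simp: orbit_altdef)
    qed
    then have "W = orbit ?T w" using T_orbit[OF _ w] by auto
    with w show "cyclic_on ?T W" by (rule cyclic_on_singleI)
  next
    assume cyc: "cyclic_on ?T W"
    then obtain w where w: "w \<in> W" "W = orbit ?T w" by (auto simp: cyclic_on_def)
    have "y \<in> V" if "y \<in> orbit f w" for y
      using that closed w(1) assms(1) by induction auto
    moreover have "v \<in> orbit f w" if v: "v \<in> V" for v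
    proof -
      obtain w' k where "w' \<in> W" "v = (f ^^ k) w'" using cover[OF v] by auto
      then show ?thesis using T_orbit[of w' w] w by (auto intro: funpow_in_orbit)
    qed
    ultimately have "V = orbit f w" by auto
    then show "cyclic_on f V" using w assms(1) by (intro cyclic_on_singleI[of w]) auto
  qed
qed

text \<open>The common target can be entered by \<open>u\<close> from \<open>v\<close> and by
  \<open>r\<close> from \<open>w\<close>, and in no other way. If only \<open>w\<close> were in
  \<open>D\<close>, both entries would be used, against injectivity; if only \<open>v\<close> were,
  neither would be, against surjectivity.\<close>

lemma branch_constant:
  assumes inj: "inj_on u V" "inj_on r V"
    and cyc: "cyclic_on (\<lambda>v. if v \<in> D then r v else u v) V"
    and vw: "v \<in> V" "w \<in> V" "u v = r w" "u v \<in> V"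
  shows "v \<in> D \<longleftrightarrow> w \<in> D"
proof (rule ccontr)
  let ?f = "\<lambda>v. if v \<in> D then r v else u v"
  assume neq: "(v \<in> D) \<noteq> (w \<in> D)"
  show False
  proof (cases "v \<in> D")
    case False
    then have "?f v = ?f w" using neq vw(3) by simp
    then have "v = w" using cyclic_on_inj_on[OF cyc] vw by (auto dest: inj_onD)
    then show False using neq by simp
  next
    case True
    have "u v \<in> ?f ` V" unfolding cyclic_on_surj[OF cyc] by (rule vw(4))
    then obtain t where t: "t \<in> V" "u v = ?f t" by (rule imageE)
    show False
    proof (cases "t \<in> D")
      case True
      then have "t = w" using t vw inj(2) by (auto dest: inj_onD)
      then show False using neq True \<open>v \<in> D\<close> by simp
    next
      case False
      then have "t = v" using t vw inj(1) by (auto dest: inj_onD)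
      then show False using False True by simp
    qed
  qed
qed

section \<open>The sheared cylinder\<close>

definition step :: "nat \<Rightarrow> int \<Rightarrow> int" where
  "step n z = (z + 1) mod (4 * int n)"

text \<open>How heights change across the cut between the last column and column 0: the left half of
  the grid continues at the same rows into the right half, and the right half wraps to the left half
  with its two blocks of \<open>n\<close> rows interchanged.\<close>

definition block_perm :: "nat \<Rightarrow> int \<Rightarrow> int" where
  "block_perm n y =
    (if y < 2 * int n then y + 2 * int n else if y < 3 * int n then y - int n else y - 3 * int n)"

text \<open>Subtracting \<open>m\<close> removes the shear accumulated over \<open>m\<close> columns
  and so recovers the height; in column 0 height and sheared coordinate agree again.\<close>

definition glue :: "nat \<Rightarrow> nat \<Rightarrow> int \<Rightarrow> int" where
  "glue n m z = block_perm n ((z - int m) mod (4 * int n))"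

text \<open>The pair \<open>(z, c)\<close> stands for the cell of column \<open>c\<close> (modulo \<open>m\<close>) at height \<open>z - c\<close>, where heights
  run up through the blocks bottom left, top left, bottom right, top right. Thanks to the shear,
  both moves advance \<open>z\<close>.\<close>

definition strip :: "nat \<Rightarrow> nat \<Rightarrow> (int \<times> nat) set" where
  "strip n m = {0..<4 * int n} \<times> {0..<m}"

definition strip_up :: "nat \<Rightarrow> int \<times> nat \<Rightarrow> int \<times> nat" where
  "strip_up n = (\<lambda>(z, c). (step n z, c))"

definition strip_right :: "nat \<Rightarrow> nat \<Rightarrow> int \<times> nat \<Rightarrow> int \<times> nat" where
  "strip_right n m =
    (\<lambda>(z, c). if c + 1 < m then (step n z, c + 1) else (glue n m (step n z), 0))"

definition cell_of :: "nat \<Rightarrow> nat \<Rightarrow> int \<times> nat \<Rightarrow> nat \<times> nat" where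
  "cell_of n m = (\<lambda>(z, c). let y = (z - int c) mod (4 * int n) in
     if y < 2 * int n then (nat (2 * int n - 1 - y), c) else (nat (4 * int n - 1 - y), c + m))"

definition cell_inv :: "nat \<Rightarrow> nat \<Rightarrow> nat \<times> nat \<Rightarrow> int \<times> nat" where
  "cell_inv n m = (\<lambda>(i, c). if c < m then ((2 * int n - 1 - int i + int c) mod (4 * int n), c)
     else ((4 * int n - 1 - int i + int (c - m)) mod (4 * int n), c - m))"

lemma step_in: "0 < n \<Longrightarrow> step n z \<in> {0..<4 * int n}"
  by (simp add: step_def)

lemma funpow_step:
  assumes "z \<in> {0..<4 * int n}"
  shows "(step n ^^ k) z = (z + int k) mod (4 * int n)"
proof (induction k)
  case (Suc k)
  then show ?case by (simp add: step_def mod_simps algebra_simps)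
qed (use assms in simp)

lemma cyclic_on_step:
  assumes "0 < n"
  shows "cyclic_on (step n) {0..<4 * int n}"
proof (rule cyclic_on_singleI)
  show "0 \<in> {0..<4 * int n}" using assms by simp
  show "{0..<4 * int n} = orbit (step n) 0"
  proof
    show "orbit (step n) 0 \<subseteq> {0..<4 * int n}"
    proof
      fix y assume "y \<in> orbit (step n) 0"
      then show "y \<in> {0..<4 * int n}" by cases (use step_in[OF assms] in auto)
    qed
    show "{0..<4 * int n} \<subseteq> orbit (step n) 0"
    proof
      fix y assume y: "y \<in> {0..<4 * int n}"
      \<comment> \<open>Orbits consist of positive iterates, so a full turn is added in order to
        reach \<open>y = 0\<close> as well.\<close>
      have "(step n ^^ nat (y + 4 * int n)) 0 = y"
        using y funpow_step[of 0 n "nat (y + 4 * int n)"] by simp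
      moreover have "0 < nat (y + 4 * int n)" using y by simp
      ultimately show "y \<in> orbit (step n) 0"
        unfolding orbit_altdef by (metis (mono_tags, lifting) mem_Collect_eq)
    qed
  qed
qed

lemma block_perm_in: "y \<in> {0..<4 * int n} \<Longrightarrow> block_perm n y \<in> {0..<4 * int n}"
  by (auto simp: block_perm_def)

lemma inj_on_block_perm: "inj_on (block_perm n) {0..<4 * int n}"
  by (rule inj_onI) (auto simp: block_perm_def split: if_splits)

lemma glue_in: "0 < n \<Longrightarrow> glue n m z \<in> {0..<4 * int n}"
  unfolding glue_def by (rule block_perm_in) simp

lemma inj_on_glue:
  assumes "0 < n"
  shows "inj_on (glue n m) {0..<4 * int n}"
proof (rule inj_onI)
  fix y z assume yz: "y \<in> {0..<4 * int n}" "z \<in> {0..<4 * int n}" "glue n m y = glue n m z"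
  let ?M = "4 * int n"
  have "(y - int m) mod ?M = (z - int m) mod ?M"
    using yz(3) inj_on_block_perm[of n] assms unfolding glue_def by (auto dest: inj_onD)
  then have "(y - int m + int m) mod ?M = (z - int m + int m) mod ?M"
    by (metis mod_add_left_eq)
  then show "y = z" using yz by simp
qed

text \<open>\<open>block_perm\<close> moves every height by a multiple of \<open>n\<close>, so
  modulo \<open>n\<close> only the shift by \<open>m\<close> survives.\<close>

lemma glue_mod: "glue n m z mod int n = (z - int m) mod int n"
proof -
  let ?y = "(z - int m) mod (4 * int n)"
  have "glue n m z mod int n = ?y mod int n"
  proof -
    have "glue n m z = ?y + 2 * int n \<or> glue n m z = ?y - 1 * int n \<or> glue n m z = ?y - 3 * int n"
      by (simp add: glue_def block_perm_def)
    then obtain k where "glue n m z = ?y + k * int n"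
      by (metis diff_conv_add_uminus mult_minus_left)
    then show ?thesis by simp
  qed
  also have "\<dots> = (z - int m) mod int n" by (simp add: mod_mod_cancel)
  finally show ?thesis .
qed

text \<open>Here \<open>12 * n\<close> is three full turns of the circle of length
  \<open>4 * n\<close>.\<close>

lemma glue_add: "glue n (m + 12 * n) = glue n m"
proof
  fix z
  have "z - int (m + 12 * n) = z - int m + (- 3) * (4 * int n)" by simp
  then have "(z - int (m + 12 * n)) mod (4 * int n) = (z - int m) mod (4 * int n)"
    by (metis mod_mult_self1)
  then show "glue n (m + 12 * n) z = glue n m z" by (simp only: glue_def)
qed

section \<open>Passage from the grid to the sheared cylinder\<close>

lemma hamiltonian_grid2_iff:
  "hamiltonian (with_proj (grid2 n m)) \<longleftrightarrow>
    (\<exists>D. cyclic_on (\<lambda>v. if v \<in> D then right n m v else up n m v) (cells n m))"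
proof -
  have "hamiltonian (with_proj (grid2 n m)) \<longleftrightarrow>
    (\<exists>f. (\<forall>v\<in>cells n m. f v = right n m v \<or> f v = up n m v) \<and> cyclic_on f (cells n m))"
    unfolding hamiltonian_iff_cyclic_on[OF pair_wf_digraph_grid2]
    by (rule ex_cong1) (auto simp: grid2_def)
  also have "\<dots> \<longleftrightarrow>
    (\<exists>D. cyclic_on (\<lambda>v. if v \<in> D then right n m v else up n m v) (cells n m))"
  proof
    assume "\<exists>f. (\<forall>v\<in>cells n m. f v = right n m v \<or> f v = up n m v) \<and> cyclic_on f (cells n m)"
    then obtain f where f: "\<And>v. v \<in> cells n m \<Longrightarrow> f v = right n m v \<or> f v = up n m v"
      "cyclic_on f (cells n m)" by blast
    define D where "D = {v. f v = right n m v}"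
    have "f v = (if v \<in> D then right n m v else up n m v)" if "v \<in> cells n m" for v
      using f(1)[OF that] by (auto simp: D_def)
    then have "cyclic_on f (cells n m) \<longleftrightarrow>
        cyclic_on (\<lambda>v. if v \<in> D then right n m v else up n m v) (cells n m)"
      by (rule cyclic_cong)
    with f(2) show "\<exists>D. cyclic_on (\<lambda>v. if v \<in> D then right n m v else up n m v) (cells n m)"
      by blast
  next
    assume "\<exists>D. cyclic_on (\<lambda>v. if v \<in> D then right n m v else up n m v) (cells n m)"
    then obtain D where "cyclic_on (\<lambda>v. if v \<in> D then right n m v else up n m v) (cells n m)"
      by blast
    then show "\<exists>f. (\<forall>v\<in>cells n m. f v = right n m v \<or> f v = up n m v) \<and> cyclic_on f (cells n m)"
      by (intro exI[of _ "\<lambda>v. if v \<in> D then right n m v else up n m v"]) simp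
  qed
  finally show ?thesis .
qed

lemma bij_betw_cell_of:
  assumes "0 < n"
  shows "bij_betw (cell_of n m) (strip n m) (cells n m)"
proof (rule bij_betw_byWitness[where f' = "cell_inv n m"])
  let ?M = "4 * int n"
  show "\<forall>a\<in>strip n m. cell_inv n m (cell_of n m a) = a"
  proof (clarify)
    fix z c assume "(z, c) \<in> strip n m"
    then have z: "0 \<le> z" "z < ?M" and c: "c < m" by (auto simp: strip_def)
    define y where "y = (z - int c) mod ?M"
    have y: "0 \<le> y" "y < ?M" using assms by (simp_all add: y_def)
    have "(y + int c) mod ?M = z" using z by (simp add: y_def mod_simps)
    then show "cell_inv n m (cell_of n m (z, c)) = (z, c)"
      using y c unfolding cell_of_def cell_inv_def by (simp add: Let_def flip: y_def)
  qed
  show "\<forall>a\<in>cells n m. cell_of n m (cell_inv n m a) = a"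
    using assms by (auto simp: cell_of_def cell_inv_def cells_def Let_def mod_simps)
  show "cell_of n m ` strip n m \<subseteq> cells n m"
  proof (rule image_subsetI)
    fix a assume "a \<in> strip n m"
    then obtain z c where a: "a = (z, c)" and c: "c < m" by (auto simp: strip_def)
    define y where "y = (z - int c) mod ?M"
    have y: "0 \<le> y" "y < ?M" using assms by (simp_all add: y_def)
    show "cell_of n m a \<in> cells n m"
      using y c assms unfolding a cell_of_def cells_def by (auto simp add: Let_def simp flip: y_def)
  qed
  show "cell_inv n m ` cells n m \<subseteq> strip n m"
    using assms by (auto simp: cell_inv_def strip_def cells_def split: if_splits)
qed

lemma up_cell_of:
  assumes "(z, c) \<in> strip n m"
  shows "up n m (cell_of n m (z, c)) = cell_of n m (strip_up n (z, c))"
proof -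
  let ?M = "4 * int n"
  have n: "0 < n" and c: "c < m" using assms by (auto simp: strip_def)
  define y where "y = (z - int c) mod ?M"
  have y: "0 \<le> y" "y < ?M" using n by (simp_all add: y_def)
  have "(step n z - int c) mod ?M = (y + 1) mod ?M"
    by (simp add: step_def y_def mod_simps algebra_simps)
  also have "\<dots> = (if y + 1 = ?M then 0 else y + 1)"
    using y by simp
  finally have y': "(step n z - int c) mod ?M = (if y + 1 = ?M then 0 else y + 1)" .
  \<comment> \<open>The cases are: inside the left column, from its top to the bottom of the right
    column, inside the right column, and from its top back to the bottom of the left one. Thus grid
    columns \<open>c\<close> and \<open>c + m\<close> form one circle of length
    \<open>4 * n\<close>.\<close>
  consider "y + 1 < 2 * int n" | "y + 1 = 2 * int n" | "2 * int n \<le> y" "y + 1 < ?M" | "y + 1 = ?M"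
    using y by linarith
  then show ?thesis
  proof cases
    case 4
    have "(c + m + m) mod (2 * m) = (c + 2 * m) mod (2 * m)" by (simp add: mult_2 add.assoc)
    then have "(c + m + m) mod (2 * m) = c" using c by simp
    with 4 show ?thesis
      using y n c unfolding cell_of_def up_def strip_up_def
      by (simp add: Let_def y' flip: y_def)
  qed (use y n c in \<open>simp add: cell_of_def up_def strip_up_def Let_def y' flip: y_def; linarith\<close>)+
qed

lemma right_cell_of:
  assumes "(z, c) \<in> strip n m"
  shows "right n m (cell_of n m (z, c)) = cell_of n m (strip_right n m (z, c))"
proof -
  let ?M = "4 * int n"
  have n: "0 < n" and c: "c < m" using assms by (auto simp: strip_def)
  define y where "y = (z - int c) mod ?M"
  have y: "0 \<le> y" "y < ?M" using n by (simp_all add: y_def)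
  \<comment> \<open>A right move raises both \<open>z\<close> and the column by one, so before any
    gluing the height \<open>y\<close> is unchanged.\<close>
  have y': "(step n z - int (Suc c)) mod ?M = y"
    by (simp add: step_def y_def mod_simps algebra_simps)
  show ?thesis
  proof (cases "Suc c < m")
    case True
    then show ?thesis
      using y n c y' unfolding cell_of_def right_def strip_right_def
      by (auto simp add: Let_def simp flip: y_def)
  next
    case False
    then have m: "Suc c = m" using c by simp
    have g: "glue n m (step n z) =
        (if y < 2 * int n then y + 2 * int n else if y < 3 * int n then y - int n else y - 3 * int n)"
      using y' unfolding glue_def m block_perm_def by simp
    have "glue n m (step n z) mod ?M = glue n m (step n z)"
      using glue_in[OF n, of m "step n z"] by simp
    then have r: "cell_of n m (strip_right n m (z, c)) =
        (if glue n m (step n z) < 2 * int n then (nat (2 * int n - 1 - glue n m (step n z)), 0)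
         else (nat (4 * int n - 1 - glue n m (step n z)), m))"
      using False by (simp add: cell_of_def strip_right_def Let_def)
    have l: "cell_of n m (z, c) =
        (if y < 2 * int n then (nat (2 * int n - 1 - y), c) else (nat (4 * int n - 1 - y), c + m))"
      by (simp add: cell_of_def Let_def flip: y_def)
    consider "y < 2 * int n" | "2 * int n \<le> y" "y < 3 * int n" | "3 * int n \<le> y" by linarith
    then show ?thesis
    proof cases
      case 1
      then show ?thesis unfolding r l g using y m by (auto simp: right_def)
    next
      case 2
      have "(nat (4 * int n - 1 - y) + n) mod (2 * n) = nat (4 * int n - 1 - y) - n"
        using 2 n by (simp add: mod_if[of "nat (4 * int n - 1 - y) + n"])
      then show ?thesis unfolding r l g using 2 y m n by (simp add: right_def) linarith
    next
      case 3
      have "(nat (4 * int n - 1 - y) + n) mod (2 * n) = nat (4 * int n - 1 - y) + n"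
        using 3 n y by simp
      then show ?thesis unfolding r l g using 3 y m n by (simp add: right_def) linarith
    qed
  qed
qed

lemma strip_up_in: "v \<in> strip n m \<Longrightarrow> strip_up n v \<in> strip n m"
  by (auto simp: strip_def strip_up_def step_def)

lemma strip_right_in:
  assumes "v \<in> strip n m"
  shows "strip_right n m v \<in> strip n m"
proof -
  obtain z c where v: "v = (z, c)" by (cases v)
  have "0 < n" "c < m" using assms by (auto simp: strip_def v)
  then show ?thesis
    using step_in[of n z] glue_in[of n m "step n z"] by (simp add: v strip_def strip_right_def)
qed

lemma hamiltonian_iff_strip:
  assumes "0 < n"
  shows "hamiltonian (with_proj (grid2 n m)) \<longleftrightarrow>
    (\<exists>D. cyclic_on (\<lambda>v. if v \<in> D then strip_right n m v else strip_up n v) (strip n m))"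
    (is "?H \<longleftrightarrow> ?S")
proof -
  let ?V = "strip n m" and ?h = "cell_of n m"
  let ?f = "\<lambda>D v. if v \<in> D then strip_right n m v else strip_up n v"
  let ?g = "\<lambda>D v. if v \<in> D then right n m v else up n m v"
  have conj: "cyclic_on (?f D) ?V \<longleftrightarrow> cyclic_on (?g E) (cells n m)"
    if DE: "\<And>v. v \<in> ?V \<Longrightarrow> v \<in> D \<longleftrightarrow> ?h v \<in> E" for D E
  proof (rule cyclic_on_conj[OF bij_betw_cell_of[OF assms]])
    fix v assume v: "v \<in> ?V"
    show "?f D v \<in> ?V" using strip_up_in[OF v] strip_right_in[OF v] by simp
    obtain z c where "v = (z, c)" by (cases v)
    then show "?g E (?h v) = ?h (?f D v)"
      using DE[OF v] up_cell_of right_cell_of v by simp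
  qed
  have inj: "inj_on ?h ?V" using bij_betw_cell_of[OF assms] by (simp add: bij_betw_def)
  show ?thesis unfolding hamiltonian_grid2_iff
  proof
    assume "\<exists>E. cyclic_on (?g E) (cells n m)"
    then obtain E where E: "cyclic_on (?g E) (cells n m)" ..
    have "cyclic_on (?f (?h -` E)) ?V \<longleftrightarrow> cyclic_on (?g E) (cells n m)"
      by (rule conj) simp
    with E show ?S by blast
  next
    assume ?S
    then obtain D where D: "cyclic_on (?f D) ?V" ..
    have "cyclic_on (?f D) ?V \<longleftrightarrow> cyclic_on (?g (?h ` (D \<inter> ?V))) (cells n m)"
      by (rule conj) (use inj in \<open>auto dest: inj_onD\<close>)
    with D show "\<exists>E. cyclic_on (?g E) (cells n m)" by blast
  qed
qed

text \<open>\<open>F\<close> records the row \<open>step n z\<close> reached by the move, not the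
  row \<open>z\<close> left. Both moves advance to that row, so \<open>glue\<close> acts on
  \<open>F\<close> directly.\<close>

definition right_cells :: "nat \<Rightarrow> int set \<Rightarrow> (int \<times> nat) set" where
  "right_cells n F = {(z, c). step n z \<in> F}"

lemma bij_betw_step:
  assumes "0 < n"
  shows "bij_betw (step n) {0..<4 * int n} {0..<4 * int n}"
  using cyclic_on_surj[OF cyclic_on_step[OF assms]] cyclic_on_inj_on[OF cyclic_on_step[OF assms]]
  by (simp add: bij_betw_def)

lemma step_eq_iff:
  assumes "y \<in> {0..<4 * int n}" "z \<in> {0..<4 * int n}"
  shows "step n y = step n z \<longleftrightarrow> y = z"
proof -
  have "0 < n" using assms by simp
  then show ?thesis using bij_betw_step[of n] assms by (auto simp: bij_betw_def dest: inj_onD)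
qed

lemma inj_on_strip_right: "inj_on (strip_right n m) (strip n m)"
proof (rule inj_onI)
  fix v w assume vw: "v \<in> strip n m" "w \<in> strip n m" "strip_right n m v = strip_right n m w"
  obtain y b z c where v: "v = (y, b)" and w: "w = (z, c)" by (cases v, cases w)
  have yz: "y \<in> {0..<4 * int n}" "z \<in> {0..<4 * int n}" and bc: "b < m" "c < m"
    using vw by (auto simp: strip_def v w)
  then have n: "0 < n" by simp
  have "step n y = step n z" and "b = c"
    using vw(3) bc inj_onD[OF inj_on_glue[OF n], of m "step n y" "step n z"] step_in[OF n]
    by (auto simp: v w strip_right_def split: if_splits)
  then show "v = w" using step_eq_iff[OF yz] by (simp add: v w)
qed

section \<open>Reduction to one column\<close>

text \<open>An up move and a right move with the same target must agree in their choice. Inside the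
  strip this makes the choice independent of the column; across the cut it makes \<open>F\<close>
  invariant under \<open>glue\<close>.\<close>

lemma right_cells_of_cyclic_on:
  assumes n: "0 < n" and m: "1 < m"
    and cyc: "cyclic_on (\<lambda>v. if v \<in> D then strip_right n m v else strip_up n v) (strip n m)"
  obtains F where "F \<subseteq> {0..<4 * int n}" "F \<noteq> {}" "glue n m ` F = F"
    "\<forall>v\<in>strip n m. v \<in> D \<longleftrightarrow> v \<in> right_cells n F"
proof -
  let ?Z = "{0..<4 * int n}"
  have inj_up: "inj_on (strip_up n) (strip n m)"
    by (rule inj_onI) (auto simp: strip_up_def strip_def step_eq_iff)
  have const: "v \<in> D \<longleftrightarrow> w \<in> D"
    if "v \<in> strip n m" "w \<in> strip n m" "strip_up n v = strip_right n m w" for v w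
    by (rule branch_constant[OF inj_up inj_on_strip_right cyc that strip_up_in[OF that(1)]])
  have column: "(z, c) \<in> D \<longleftrightarrow> (z, 0) \<in> D" if "z \<in> ?Z" "c < m" for z c
    using that(2)
  proof (induction c)
    case (Suc c)
    have "(z, Suc c) \<in> D \<longleftrightarrow> (z, c) \<in> D"
      by (rule const) (use that(1) Suc.prems in \<open>auto simp: strip_def strip_up_def strip_right_def\<close>)
    then show ?case using Suc by simp
  qed simp
  define F where "F = step n ` {z \<in> ?Z. (z, 0) \<in> D}"
  have F: "F \<subseteq> ?Z" using step_in[OF n] by (auto simp: F_def)
  have D: "v \<in> D \<longleftrightarrow> v \<in> right_cells n F" if "v \<in> strip n m" for v
  proof -
    obtain z c where v: "v = (z, c)" by (cases v)
    have z: "z \<in> ?Z" "c < m" using that by (auto simp: v strip_def)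
    have "step n z \<in> F \<longleftrightarrow> (z, 0) \<in> D"
      using z(1) step_eq_iff[OF z(1)] by (auto simp: F_def)
    then show ?thesis using column[OF z] by (simp add: v right_cells_def)
  qed
  have "glue n m x \<in> F" if x: "x \<in> F" for x
  proof -
    obtain z where z: "z \<in> ?Z" "(z, 0) \<in> D" "x = step n z" using x by (auto simp: F_def)
    have "glue n m x \<in> step n ` ?Z"
      using bij_betw_step[OF n] glue_in[OF n] by (simp add: bij_betw_def)
    then obtain y where y: "y \<in> ?Z" "glue n m x = step n y" by auto
    \<comment> \<open>Up from \<open>(y, 0)\<close> and right from \<open>(z, m - 1)\<close> both
      arrive at \<open>(glue n m x, 0)\<close>.\<close>
    have "(y, 0) \<in> D \<longleftrightarrow> (z, m - 1) \<in> D"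
      by (rule const) (use y z m in \<open>auto simp: strip_def strip_up_def strip_right_def\<close>)
    then have "(y, 0) \<in> D" using column[of z "m - 1"] z m by simp
    then show ?thesis using y by (auto simp: F_def)
  qed
  then have "glue n m ` F = F"
    using F finite_subset[OF F] inj_on_subset[OF inj_on_glue[OF n] F]
    by (intro endo_inj_surj) auto
  moreover have "F \<noteq> {}"
  proof
    \<comment> \<open>Without right moves the path from \<open>(0, 0)\<close> never leaves column 0
      and misses \<open>(0, 1)\<close>.\<close>
    assume "F = {}"
    let ?f = "\<lambda>v. if v \<in> D then strip_right n m v else strip_up n v"
    have up: "?f v = strip_up n v" if "v \<in> strip n m" for v
      using D[OF that] \<open>F = {}\<close> by (auto simp: right_cells_def split: prod.splits)
    have in_strip: "(0, 0) \<in> strip n m" "(0, 1) \<in> strip n m"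
      using n m by (auto simp: strip_def)
    have "snd v = 0 \<and> v \<in> strip n m" if "v \<in> orbit ?f (0, 0)" for v
      using that
    proof induction
      case base
      show ?case using up[OF in_strip(1)] strip_up_in[OF in_strip(1)] by (simp add: strip_up_def)
    next
      case (step y)
      then show ?case using up[of y] strip_up_in[of y n m] by (simp add: strip_up_def split: prod.splits)
    qed
    from this[of "(0, 1)"] show False
      using orbit_cyclic_eq3[OF cyc in_strip(1)] in_strip(2) by simp
  qed
  ultimately show ?thesis using that[of F] F D by blast
qed

section \<open>Visits of the row rotation to \<open>F\<close>, and the return map to column
  0\<close>

lemma step_returns:
  assumes "F \<subseteq> {0..<4 * int n}" "F \<noteq> {}" "z \<in> {0..<4 * int n}"
  shows "\<exists>k>0. (step n ^^ k) z \<in> F"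
proof -
  have "0 < n" using assms(3) by simp
  obtain x where "x \<in> F" using assms(2) by auto
  moreover have "x \<in> orbit (step n) z"
    using orbit_cyclic_eq3[OF cyclic_on_step[OF \<open>0 < n\<close>] assms(3)] assms(1) \<open>x \<in> F\<close> by auto
  ultimately show ?thesis by (auto simp: orbit_altdef)
qed

lemma step_covers:
  assumes "F \<subseteq> {0..<4 * int n}" "F \<noteq> {}" "z \<in> {0..<4 * int n}"
  obtains x k where "x \<in> F" "z = (step n ^^ k) x"
    "\<And>i. 0 < i \<Longrightarrow> i \<le> k \<Longrightarrow> (step n ^^ i) x \<notin> F"
proof -
  let ?P = "\<lambda>k. \<exists>x\<in>F. z = (step n ^^ k) x"
  have "0 < n" using assms(3) by simp
  obtain x where "x \<in> F" using assms(2) by auto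
  moreover have "z \<in> orbit (step n) x"
    using orbit_cyclic_eq3[OF cyclic_on_step[OF \<open>0 < n\<close>], of x] assms(1,3) \<open>x \<in> F\<close> by auto
  ultimately have ex: "\<exists>k. ?P k" by (auto simp: orbit_altdef)
  \<comment> \<open>The least such \<open>k\<close> picks the last element of \<open>F\<close> met
    before \<open>z\<close>, so no visit to \<open>F\<close> lies in between.\<close>
  define k where "k = (LEAST k. ?P k)"
  obtain y where y: "y \<in> F" "z = (step n ^^ k) y"
    using LeastI_ex[OF ex] unfolding k_def by auto
  have "(step n ^^ i) y \<notin> F" if "0 < i" "i \<le> k" for i
  proof
    assume i: "(step n ^^ i) y \<in> F"
    have "z = (step n ^^ (k - i)) ((step n ^^ i) y)"
      using y(2) that funpow_add[where m = "k - i" and n = i and f = "step n"] by simp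
    with i have "?P (k - i)" by blast
    then have "k \<le> k - i" unfolding k_def by (rule Least_le)
    with that show False by simp
  qed
  with y that show ?thesis by blast
qed

lemma cyclic_on_next_visit:
  assumes F: "F \<subseteq> {0..<4 * int n}" "F \<noteq> {}"
  shows "cyclic_on (first_return (step n) F) F"
proof (rule cyclic_on_first_return[THEN iffD1, OF F])
  have n: "0 < n" using F by force
  show "step n z \<in> {0..<4 * int n}" for z using step_in[OF n] .
  show "cyclic_on (step n) {0..<4 * int n}" using cyclic_on_step[OF n] .
  show "\<exists>w\<in>F. \<exists>k. v = (step n ^^ k) w" if "v \<in> {0..<4 * int n}" for v
    using step_covers[OF F that] by metis
  show "\<exists>k>0. (step n ^^ k) w \<in> F" if "w \<in> F" for w
    using step_returns[OF F] that F(1) by auto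
qed

text \<open>Two first-return reductions are composed: first to the cells whose row lies in
  \<open>F\<close>, which are the cells entered by right moves, and then to those among them in
  column 0.\<close>

lemma cyclic_on_strip_iff:
  assumes F: "F \<subseteq> {0..<4 * int n}" "F \<noteq> {}" and glue: "glue n m ` F = F" and m: "0 < m"
  shows "cyclic_on (\<lambda>v. if v \<in> right_cells n F then strip_right n m v else strip_up n v) (strip n m)
    \<longleftrightarrow> cyclic_on (\<lambda>z. glue n m ((first_return (step n) F ^^ m) z)) F"
proof -
  let ?Z = "{0..<4 * int n}"
  define f where "f = (\<lambda>v. if v \<in> right_cells n F then strip_right n m v else strip_up n v)"
  define N where "N = first_return (step n) F"
  define S where "S = (\<lambda>(z, c). if c + 1 < m then (N z, c + 1) else (glue n m (N z), 0::nat))"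
  let ?W = "F \<times> {0..<m}" and ?B = "F \<times> {0::nat}"
  have n: "0 < n" using F by force
  have cycN: "cyclic_on N F"
    unfolding N_def by (rule cyclic_on_next_visit[OF F])
  have NF: "N z \<in> F" if "z \<in> F" for z using cyclic_on_inI[OF cycN that] .
  have f_in: "f v \<in> strip n m" if "v \<in> strip n m" for v
    using strip_up_in[OF that] strip_right_in[OF that] by (simp add: f_def)
  have f_up: "(f ^^ k) (z, c) = ((step n ^^ k) z, c)"
    if "\<And>i. 0 < i \<Longrightarrow> i \<le> k \<Longrightarrow> (step n ^^ i) z \<notin> F" for k z c
    using that
  proof (induction k)
    case (Suc k)
    have "(f ^^ k) (z, c) = ((step n ^^ k) z, c)" using Suc by simp
    moreover have "step n ((step n ^^ k) z) \<notin> F" using Suc.prems[of "Suc k"] by simp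
    ultimately show ?case by (simp add: f_def right_cells_def strip_up_def)
  qed simp
  \<comment> \<open>From \<open>(z, c)\<close> the path goes up \<open>d - 1\<close> times until the
    next row of \<open>F\<close> is one step ahead; move number \<open>d\<close> is then a right
    move into row \<open>N z\<close>, followed by gluing if it leaves the last column.\<close>
  have ret: "first_return f ?W v = S v \<and> (\<exists>k>0. (f ^^ k) v = S v) \<and> S v \<in> ?W" if v: "v \<in> ?W" for v
  proof -
    obtain z c where zc: "v = (z, c)" "z \<in> F" "c < m" using v by (cases v) simp
    obtain k where "0 < k" "(step n ^^ k) z \<in> F" using step_returns[OF F] zc(2) F(1) by blast
    then obtain d where d: "0 < d" "d \<le> k" "(step n ^^ d) z \<in> F" "N z = (step n ^^ d) z"
      "\<forall>j. 0 < j \<longrightarrow> j < d \<longrightarrow> (step n ^^ j) z \<notin> F"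
      unfolding N_def by (rule first_returnE)
    obtain e where e: "d = Suc e" using d(1) by (cases d) auto
    have before: "(f ^^ j) v = ((step n ^^ j) z, c)" if "j \<le> e" for j
      unfolding zc(1) by (rule f_up) (use d(5) e that in auto)
    have Nz: "step n ((step n ^^ e) z) = N z" using d(4) e by simp
    have "(f ^^ d) v = f ((step n ^^ e) z, c)" using before[of e] e by simp
    also have "\<dots> = S v"
      using Nz NF[OF zc(2)] by (simp add: f_def right_cells_def strip_right_def S_def zc(1))
    finally have fd: "(f ^^ d) v = S v" .
    have SW: "S v \<in> ?W"
      using NF[OF zc(2)] glue m by (auto simp: S_def zc(1))
    have "(f ^^ j) v \<notin> ?W" if "0 < j" "j < d" for j
      using before[of j] d(5) that e by simp
    then have "first_return f ?W v = (f ^^ d) v"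
      using d(1) fd SW by (intro first_return_eqI) simp_all
    then show ?thesis using fd SW d(1) by auto
  qed
  have pow: "(S ^^ j) (z, 0) = ((N ^^ j) z, j)" if "j < m" for j z
    using that by (induction j) (auto simp: S_def)
  have powm: "(S ^^ m) (z, 0) = (glue n m ((N ^^ m) z), 0)" for z
    using pow[of "m - 1" z] m by (cases m) (auto simp: S_def)
  have retm: "glue n m ((N ^^ m) z) \<in> F" if "z \<in> F" for z
    using cyclic_on_funpow_in[OF cycN that] glue by auto
  have first_S: "first_return S ?B (z, 0) = (glue n m ((N ^^ m) z), 0)" if "z \<in> F" for z
  proof -
    have "first_return S ?B (z, 0) = (S ^^ m) (z, 0)"
      using m powm[of z] retm[OF that] by (intro first_return_eqI) (simp_all add: pow)
    then show ?thesis using powm by simp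
  qed
  have "cyclic_on f (strip n m) \<longleftrightarrow> cyclic_on (first_return f ?W) ?W"
  proof (rule cyclic_on_first_return)
    show "?W \<subseteq> strip n m" using F by (auto simp: strip_def)
    show "?W \<noteq> {}" using F(2) m by auto
    show "\<exists>w\<in>?W. \<exists>k. v = (f ^^ k) w" if vX: "v \<in> strip n m" for v
    proof -
      obtain z c where v: "v = (z, c)" "z \<in> ?Z" "c < m"
        using vX by (cases v) (simp add: strip_def)
      obtain x k where x: "x \<in> F" "z = (step n ^^ k) x"
        "\<And>i. 0 < i \<Longrightarrow> i \<le> k \<Longrightarrow> (step n ^^ i) x \<notin> F"
        using step_covers[OF F v(2)] by metis
      have "(f ^^ k) (x, c) = v" using f_up[OF x(3)] x(2) v(1) by simp
      moreover have "(x, c) \<in> ?W" using x(1) v(3) by simp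
      ultimately show ?thesis by blast
    qed
    show "\<exists>k>0. (f ^^ k) w \<in> ?W" if "w \<in> ?W" for w
      using ret[OF that] by metis
  qed (rule f_in)
  also have "\<dots> \<longleftrightarrow> cyclic_on S ?W"
    by (rule cyclic_cong) (use ret in blast)
  also have "\<dots> \<longleftrightarrow> cyclic_on (first_return S ?B) ?B"
  proof -
    show ?thesis
    proof (rule cyclic_on_first_return)
      show "?B \<subseteq> ?W" "?B \<noteq> {}" using m F(2) by auto
      show "S v \<in> ?W" if "v \<in> ?W" for v using ret[OF that] by simp
      show "\<exists>w\<in>?B. \<exists>k. v = (S ^^ k) w" if vX: "v \<in> ?W" for v
      proof -
        obtain z c where v: "v = (z, c)" "z \<in> F" "c < m" using vX by (cases v) simp
        have "(N ^^ c) ` F = F"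
        proof (induction c)
          case (Suc c)
          have "(N ^^ Suc c) ` F = N ` (N ^^ c) ` F" by (simp add: image_image comp_def)
          then show ?case by (simp only: Suc.IH cyclic_on_surj[OF cycN])
        qed simp
        then obtain x where "x \<in> F" "z = (N ^^ c) x" using v(2) by blast
        then have "(x, 0) \<in> ?B" "v = (S ^^ c) (x, 0)" using pow[OF v(3)] v(1) by simp_all
        then show ?thesis by blast
      qed
      show "\<exists>k>0. (S ^^ k) w \<in> ?B" if "w \<in> ?B" for w
        using that powm retm m by (intro exI[of _ m]) auto
    qed
  qed
  also have "\<dots> \<longleftrightarrow> cyclic_on (\<lambda>z. glue n m ((N ^^ m) z)) F"
    by (rule cyclic_on_conj[symmetric, where h = "\<lambda>z. (z, 0)"])
      (use retm first_S in \<open>auto simp: bij_betw_def inj_on_def\<close>)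
  finally show ?thesis unfolding f_def N_def .
qed

text \<open>\<open>glue\<close> permutes \<open>F\<close> and shifts residues modulo
  \<open>n\<close> by \<open>- m\<close>. By coprimality all \<open>n\<close> classes are linked, so
  they meet \<open>F\<close> equally often: at least once, and at most four times because there are
  \<open>4 * n\<close> rows. Each of 1, 2, 3, 4 divides 12.\<close>

lemma card_glue_invariant:
  assumes F: "F \<subseteq> {0..<4 * int n}" "F \<noteq> {}" and glue: "glue n m ` F = F" and "coprime n m"
  shows "card F dvd 12 * n"
proof -
  have n: "0 < n" using F by force
  have fin: "finite F" using F(1) finite_subset by blast
  define C where "C r = {z \<in> F. z mod int n = r mod int n}" for r
  have C_cong: "C r = C s" if "r mod int n = s mod int n" for r s
    using that by (simp add: C_def)
  have inj: "inj_on (glue n m) F" using inj_on_subset[OF inj_on_glue[OF n] F(1)] .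
  have "glue n m ` C r = C (r - int m)" for r
  proof -
    have "(z - int m) mod int n = (r - int m) mod int n \<longleftrightarrow> z mod int n = r mod int n" for z
      by (simp add: mod_eq_dvd_iff)
    then have iff: "glue n m z mod int n = (r - int m) mod int n \<longleftrightarrow> z mod int n = r mod int n" for z
      by (simp add: glue_mod)
    have "C (r - int m) = {z \<in> glue n m ` F. z mod int n = (r - int m) mod int n}"
      unfolding C_def glue ..
    also have "\<dots> = glue n m ` C r"
      unfolding C_def using iff by blast
    finally show ?thesis by simp
  qed
  then have shift: "card (C r) = card (C (r - int m))" for r
    using card_image[OF inj_on_subset[OF inj], of "C r"] by (auto simp: C_def)
  have shifts: "card (C r) = card (C (r - int k * int m))" for r k
  proof (induction k)
    case (Suc k)
    then show ?case using shift[of "r - int k * int m"] by (simp add: algebra_simps)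
  qed simp
  have eq: "card (C r) = card (C 0)" for r
  proof -
    have "coprime (int m) (int n)" using assms(4) by (simp add: coprime_commute)
    then have "gcd (int m) (int n) = 1" by (rule coprime_imp_gcd_eq_1)
    then obtain a b where ab: "a * int m + b * int n = 1" using bezout_int[of "int m" "int n"] by auto
    \<comment> \<open>By Bezout \<open>a\<close> inverts \<open>m\<close> modulo \<open>n\<close>,
      so \<open>r * a\<close> shifts by \<open>m\<close> carry class \<open>r\<close> to class 0;
      reducing modulo \<open>n\<close> makes this count a natural number.\<close>
    define k where "k = nat ((r * a) mod int n)"
    have "int k = r * a - int n * ((r * a) div int n)"
      using n by (simp add: k_def minus_mult_div_eq_mod)
    then have "r - int k * int m = r - (r * a - int n * ((r * a) div int n)) * int m"
      by simp
    also have "\<dots> = r * (1 - a * int m) + int n * ((r * a) div int n) * int m"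
      by (simp add: algebra_simps)
    also have "1 - a * int m = b * int n" using ab by simp
    also have "r * (b * int n) + int n * ((r * a) div int n) * int m
        = int n * (r * b + ((r * a) div int n) * int m)" by (simp add: algebra_simps)
    finally have "(r - int k * int m) mod int n = 0 mod int n" by simp
    then show ?thesis using shifts[of r k] C_cong by metis
  qed
  have "card F = (\<Sum>z\<in>F. 1)" by simp
  also have "\<dots> = (\<Sum>r\<in>{0..<int n}. \<Sum>z\<in>{z \<in> F. z mod int n = r}. 1)"
    using fin n by (intro sum.group[symmetric]) auto
  also have "\<dots> = (\<Sum>r\<in>{0..<int n}. card (C r))"
    by (intro sum.cong) (auto simp: C_def)
  also have "\<dots> = (\<Sum>r\<in>{0..<int n}. card (C 0))" by (rule sum.cong[OF refl eq])
  also have "\<dots> = n * card (C 0)" by simp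
  finally have card: "card F = n * card (C 0)" .
  have "C 0 \<subseteq> (\<lambda>k. k * int n) ` {0..<4}"
  proof
    fix z assume "z \<in> C 0"
    then have z: "z \<in> {0..<4 * int n}" "z mod int n = 0" using F(1) by (auto simp: C_def)
    from mod_0_imp_dvd[OF z(2)] obtain k where "z = int n * k" by (rule dvdE)
    then have k: "z = k * int n" by simp
    have "0 \<le> k" "k < 4" using z(1) n unfolding k by (auto simp: zero_le_mult_iff)
    then show "z \<in> (\<lambda>k. k * int n) ` {0..<4}" using k by auto
  qed
  then have "card (C 0) \<le> card ((\<lambda>k. k * int n) ` {0..<4})" by (intro card_mono) auto
  also have "\<dots> \<le> 4" using card_image_le[of "{0..<4::int}" "\<lambda>k. k * int n"] by simp
  finally have "card (C 0) \<le> 4" .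
  moreover have "card (C 0) \<noteq> 0" using card fin F(2) by auto
  ultimately have "card (C 0) \<in> {1, 2, 3, 4}" by auto
  then have "card (C 0) dvd 12" by auto
  then show ?thesis unfolding card by (simp add: mult.commute)
qed

text \<open>In this criterion \<open>m\<close> enters only through \<open>glue n m\<close> and the
  exponent of the next-visit map.\<close>

lemma hamiltonian_iff_ex_rows:
  assumes "0 < n" "1 < m"
  shows "hamiltonian (with_proj (grid2 n m)) \<longleftrightarrow>
    (\<exists>F. F \<subseteq> {0..<4 * int n} \<and> F \<noteq> {} \<and> glue n m ` F = F \<and>
      cyclic_on (\<lambda>z. glue n m ((first_return (step n) F ^^ m) z)) F)"
    (is "_ \<longleftrightarrow> ?R")
  unfolding hamiltonian_iff_strip[OF assms(1)]
proof
  assume "\<exists>D. cyclic_on (\<lambda>v. if v \<in> D then strip_right n m v else strip_up n v) (strip n m)"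
  then obtain D where
    D: "cyclic_on (\<lambda>v. if v \<in> D then strip_right n m v else strip_up n v) (strip n m)" ..
  obtain F where F: "F \<subseteq> {0..<4 * int n}" "F \<noteq> {}" "glue n m ` F = F"
    and DF: "\<forall>v\<in>strip n m. v \<in> D \<longleftrightarrow> v \<in> right_cells n F"
    by (rule right_cells_of_cyclic_on[OF assms D])
  have "cyclic_on (\<lambda>v. if v \<in> D then strip_right n m v else strip_up n v) (strip n m) \<longleftrightarrow>
      cyclic_on (\<lambda>v. if v \<in> right_cells n F then strip_right n m v else strip_up n v) (strip n m)"
    by (rule cyclic_cong) (simp add: DF)
  then show ?R using D F cyclic_on_strip_iff[OF F] assms(2) by auto
next
  assume ?R
  then obtain F where "F \<subseteq> {0..<4 * int n}" "F \<noteq> {}" "glue n m ` F = F"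
    "cyclic_on (\<lambda>z. glue n m ((first_return (step n) F ^^ m) z)) F" by blast
  then show "\<exists>D. cyclic_on (\<lambda>v. if v \<in> D then strip_right n m v else strip_up n v) (strip n m)"
    using cyclic_on_strip_iff[of F n m] assms(2) by auto
qed

theorem theorem3:
  fixes n m :: nat
  assumes "n > 1" and "m > 1" and "coprime n m"
  shows "hamiltonian (with_proj (grid2 n m)) \<longleftrightarrow> hamiltonian (with_proj (grid2 n (m + 12 * n)))"
proof -
  have "cyclic_on (\<lambda>z. glue n m ((first_return (step n) F ^^ m) z)) F \<longleftrightarrow>
      cyclic_on (\<lambda>z. glue n m ((first_return (step n) F ^^ (m + 12 * n)) z)) F"
    if F: "F \<subseteq> {0..<4 * int n}" "F \<noteq> {}" "glue n m ` F = F" for F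
  proof (rule cyclic_cong)
    fix z assume z: "z \<in> F"
    let ?N = "first_return (step n) F"
    have "(?N ^^ card F) z = z"
      using funpow_card_cyclic_on[OF cyclic_on_next_visit[OF F(1,2)] z] .
    \<comment> \<open>The next-visit map has period \<open>card F\<close> on \<open>F\<close>, and
      \<open>card F\<close> divides \<open>12 * n\<close>, so the two exponents give the same
      iterate.\<close>
    moreover have "(m + 12 * n) mod card F = m mod card F"
      using card_glue_invariant[OF F assms(3)] by (metis mod_add_right_eq mod_0_imp_dvd dvd_imp_mod_0 add_0_right)
    ultimately have "(?N ^^ m) z = (?N ^^ (m + 12 * n)) z"
      by (metis funpow_mod_eq)
    then show "glue n m ((?N ^^ m) z) = glue n m ((?N ^^ (m + 12 * n)) z)" by simp
  qed
  then show ?thesis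
    \<comment> \<open>Since \<open>glue_add\<close> identifies the two gluing maps, the same sets
      \<open>F\<close> witness both sides.\<close>
    using assms by (simp add: hamiltonian_iff_ex_rows glue_add) metis
qed

end
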